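(* Let $(T_n(x))_{n\ge0}$ be real polynomials with $\deg(T_n(x))=m_n$, $m_{n+1}=m_n+1$, satisfying for $n\ge 0$ $$T_{n+1}(x)=\bigl(-m_n\mu_n x^2+\beta_n x+\beta_n+m_n\nu_n\bigr)T_n(x)+\bigl(\mu_n x^3+\nu_n x^2-\nu_n x-\mu_n\bigr)\frac{d}{dx}T_n(x),$$ where $\beta_n,\mu_n,\nu_n$ are real sequences with $\mu_n\le 0\le\nu_n$. Assume that $T_0(x)$ is symmetric with positive leading coefficient and is Hurwitz stable. If $\mu_n+\nu_n\le 0$ and $2\beta_n+m_n(\mu_n+\nu_n)\ge 0$ for all $n$, then $T_n(x)$ is Hurwitz stable and semi-$\gamma$-positive for all $n$.
   Context: A polynomial $f\in\mathbb{C}[x]$ is Hurwitz stable if it is identically zero or $f(x)\ne0$ whenever $\Re(x)>0$. A polynomial $f$ of degree $d$ is symmetric if $f(x)=x^df(1/x)$. A symmetric polynomial $f$ of degree $d=2N+\nu$, $\nu\in\{0,1\}$, can be written as $f(x)=(1+x)^{\nu}\sum_{k=0}^{N}g_kx^k(1+x^2)^{N-k}$; it is semi-$\gamma$-positive if all $g_k\ge0$. *)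

theory Defs
  imports Complex_Main "HOL-Computational_Algebra.Polynomial"
begin

definition hurwitz_stable :: "complex poly \<Rightarrow> bool" where
  "hurwitz_stable f \<longleftrightarrow> f = 0 \<or> (\<forall>x. Re x > 0 \<longrightarrow> poly f x \<noteq> 0)"

text \<open>
  The identity \<open>f(x) = x\<^sup>d f(1/x)\<close> is one of rational functions; over an infinite field
  it suffices to require it at all nonzero points.
\<close>
definition symmetric_poly :: "'a::field_char_0 poly \<Rightarrow> bool" where
  "symmetric_poly f \<longleftrightarrow> (\<forall>x. x \<noteq> 0 \<longrightarrow> poly f x = x ^ degree f * poly f (1 / x))"

text \<open>
  Here \<open>N = degree f div 2\<close> and \<open>\<nu> = degree f mod 2\<close>, i.e. \<open>degree f = 2 N + \<nu>\<close>
  with \<open>\<nu> \<in> {0, 1}\<close>; the coefficients \<open>g\<^sub>k\<close> are uniquely determined by \<open>f\<close>, since the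
  polynomials \<open>x\<^sup>k (1 + x\<^sup>2)\<^sup>N\<^sup>-\<^sup>k\<close> with \<open>k \<le> N\<close> are linearly independent.
\<close>
definition semi_gamma_positive :: "real poly \<Rightarrow> bool" where
  "semi_gamma_positive f \<longleftrightarrow> symmetric_poly f \<and>
     (let N = degree f div 2; \<nu> = degree f mod 2 in
      \<exists>g :: nat \<Rightarrow> real.
        f = [:1, 1:] ^ \<nu> * (\<Sum>k=0..N. smult (g k) ([:0, 1:] ^ k * [:1, 0, 1:] ^ (N - k)))
        \<and> (\<forall>k\<le>N. g k \<ge> 0))"

end

(* The substitution w = x + 1/x maps the open right half-plane onto itself, as Re x and
   Re (1/x) have the same sign. A symmetric f of degree d = 2N + e equals
   (1+x)^e x^N G(w), the coefficients of G being the g_k, so f is Hurwitz stable iff G is;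
   a real stable G with positive leading coefficient is a product of real linear and
   quadratic factors with nonnegative coefficients, whence semi-gamma-positivity.

   For stability of T_(n+1), write v = 2 G'(w)/G(w) + e/(w+2), M = -mu, K = -(mu+nu),
   B = beta + d(mu+nu)/2. The symmetry of T_n turns the recurrence into
     T_(n+1) / ((1+x) T_n) = B + (d M w - (M w + K)(w-2) v) / 2.
   Now v is a sum of d numbers 1/(w-s) with Re s <= 0, hence v = 0 or v = d/(w+z) with
   Re z >= 0 (Laguerre), and a zero would make a bilinear form in w, z with nonnegative
   coefficients vanish on the right half-plane. *)

theory Submission
  imports Defs "HOL-Computational_Algebra.Fundamental_Theorem_Algebra"
begin

section \<open>Real polynomials read over the complex numbers\<close>

abbreviation cpoly :: "real poly \<Rightarrow> complex poly" where
  "cpoly \<equiv> map_poly complex_of_real"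

lemma cpoly_add: "cpoly (p + q) = cpoly p + cpoly q"
  by (rule poly_eqI) (simp add: coeff_map_poly)

lemma cpoly_smult: "cpoly (smult c p) = smult (of_real c) (cpoly p)"
  by (rule poly_eqI) (simp add: coeff_map_poly)

lemma cpoly_mult: "cpoly (p * q) = cpoly p * cpoly q"
  by (rule poly_eqI) (simp add: coeff_map_poly coeff_mult)

lemma cpoly_power: "cpoly (p ^ n) = cpoly p ^ n"
  by (induction n) (simp_all add: cpoly_mult)

lemma cpoly_sum: "cpoly (sum f A) = (\<Sum>i\<in>A. cpoly (f i))"
  by (induction A rule: infinite_finite_induct) (simp_all add: cpoly_add)

lemma cpoly_pderiv: "cpoly (pderiv p) = pderiv (cpoly p)"
  by (rule poly_eqI) (simp add: coeff_map_poly coeff_pderiv)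

lemma poly_cpoly_of_real: "poly (cpoly p) (of_real x) = of_real (poly p x)"
  by (induction p) (simp_all add: map_poly_pCons)

lemma degree_cpoly [simp]: "degree (cpoly p) = degree p"
  by (rule degree_map_poly) simp

lemma cpoly_eq_0_iff [simp]: "cpoly p = 0 \<longleftrightarrow> p = 0"
  by (rule map_poly_eq_0_iff) auto

section \<open>Palindromic polynomials and their gamma expansion\<close>

lemma poly_eqI_nonzero:
  fixes p q :: "'a::field_char_0 poly"
  assumes "\<And>x. x \<noteq> 0 \<Longrightarrow> poly p x = poly q x"
  shows "p = q"
proof (rule ccontr)
  assume "p \<noteq> q"
  then have "finite {x. poly (p - q) x = 0}"
    by (intro poly_roots_finite) simp
  moreover have "UNIV - {0} \<subseteq> {x. poly (p - q) x = 0}"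
    using assms by (simp add: subset_iff)
  ultimately have "finite (UNIV - {0 :: 'a})"
    by (rule rev_finite_subset)
  then show False
    using infinite_UNIV_char_0[where 'a = 'a] by simp
qed

text \<open>The symmetry turns \<open>x ^ degree f * f\<close> into \<open>x ^ d\<close> times the
  reversed polynomial, whose degree is at most that of \<open>f\<close>; comparing degrees gives the
  bound.\<close>

lemma palindromic_degree_le:
  fixes f :: "'a::field_char_0 poly"
  assumes sym: "\<And>x. x \<noteq> 0 \<Longrightarrow> poly f x = x ^ d * poly f (1 / x)"
  shows "degree f \<le> d"
proof (cases "f = 0")
  case False
  have "monom 1 (degree f) * f = monom 1 d * reflect_poly f"
  proof (rule poly_eqI_nonzero)
    fix x :: 'a
    assume "x \<noteq> 0"
    then show "poly (monom 1 (degree f) * f) x = poly (monom 1 d * reflect_poly f) x"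
      using sym[of x] by (simp add: poly_monom poly_reflect_poly_nz field_simps)
  qed
  then have "degree (monom 1 (degree f) * f) = degree (monom 1 d * reflect_poly f)" by simp
  then have "degree f + degree f = d + degree (reflect_poly f)"
    using False by (simp add: degree_mult_eq degree_monom_eq)
  then show ?thesis
    using degree_reflect_poly_le[of f] by linarith
qed simp

lemma symmetric_poly_coeff_0:
  fixes f :: "'a::field_char_0 poly"
  assumes "symmetric_poly f"
  shows "coeff f 0 = lead_coeff f"
proof -
  have "f = reflect_poly f"
  proof (rule poly_eqI_nonzero)
    fix x :: 'a
    assume "x \<noteq> 0"
    then have "poly f x = x ^ degree f * poly f (1 / x)"
      using assms unfolding symmetric_poly_def by blast
    with \<open>x \<noteq> 0\<close> show "poly f x = poly (reflect_poly f) x"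
      by (metis poly_reflect_poly_nz inverse_eq_divide)
  qed
  then show ?thesis by (metis coeff_0_reflect_poly)
qed

text \<open>Subtracting the multiple of the \<open>k = 0\<close> basis polynomial that kills the
  constant term leaves \<open>x * h\<close>, with \<open>h\<close> palindromic for the exponent
  \<open>d - 2\<close>. The exponent \<open>d\<close> is kept apart from the degree because
  \<open>h\<close> may have degree below \<open>d - 2\<close>.\<close>

lemma palindromic_gamma_expansion:
  fixes f :: "'a::field_char_0 poly"
  assumes sym: "\<And>x. x \<noteq> 0 \<Longrightarrow> poly f x = x ^ d * poly f (1 / x)"
  shows "\<exists>g. f = [:1, 1:] ^ (d mod 2) *
    (\<Sum>k=0..d div 2. smult (g k) ([:0, 1:] ^ k * [:1, 0, 1:] ^ (d div 2 - k)))"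
  using sym
proof (induction d arbitrary: f rule: less_induct)
  case (less d)
  have deg_le: "degree f \<le> d"
    by (rule palindromic_degree_le) (rule less.prems)
  consider "d = 0" | "d = 1" | "d \<ge> 2" by linarith
  then show ?case
  proof cases
    case 1
    with deg_le have "degree f = 0" by simp
    then obtain a where "f = [:a:]" by (rule degree_eq_zeroE)
    with 1 show ?thesis by (intro exI[of _ "\<lambda>_. a"]) simp
  next
    case 2
    with deg_le have "degree f \<le> 1" by simp
    then have "f = [:coeff f 0, coeff f 1:]"
      by (intro poly_eqI) (auto simp: coeff_pCons coeff_eq_0 split: nat.splits)
    then obtain a b where f: "f = [:a, b:]" by blast
    \<comment> \<open>At the point 2 the symmetry reads \<open>a + 2 * b = 2 * a + b\<close>; at 1
      it would be void.\<close>
    have "a = b"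
      using less.prems[of 2] 2 f by (simp add: algebra_simps)
    with 2 f show ?thesis by (intro exI[of _ "\<lambda>_. a"]) simp
  next
    case 3
    define e where "e = d mod 2"
    obtain N where N_Suc: "d div 2 = Suc N"
      using 3 by (cases "d div 2") auto
    have d_eq: "d = 2 * Suc N + e"
      using N_Suc unfolding e_def by (metis mult_div_mod_eq)
    have "e < 2" by (simp add: e_def)
    then have N: "(d - 2) div 2 = N" "(d - 2) mod 2 = e"
      unfolding d_eq by simp_all
    define q :: "'a poly" where "q = [:1, 1:] ^ e * [:1, 0, 1:] ^ Suc N"
    have q_sym: "poly q x = x ^ d * poly q (1 / x)" if "x \<noteq> 0" for x
    proof -
      have "1 + x = x * (1 + 1 / x)" "1 + x * x = x\<^sup>2 * (1 + 1 / x * (1 / x))"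
        using that by (simp_all add: field_simps power2_eq_square)
      then have "poly q x = (x * (1 + 1 / x)) ^ e * (x\<^sup>2 * (1 + 1 / x * (1 / x))) ^ Suc N"
        unfolding q_def poly_mult poly_power by simp
      also have "\<dots> = x ^ e * (x\<^sup>2) ^ Suc N * poly q (1 / x)"
        unfolding q_def poly_mult poly_power power_mult_distrib by (simp add: mult_ac)
      also have "x ^ e * (x\<^sup>2) ^ Suc N = x ^ d"
        unfolding d_eq power_add power_mult by (rule mult.commute)
      finally show ?thesis .
    qed
    define r where "r = f - smult (coeff f 0) q"
    have "coeff r 0 = 0"
      unfolding r_def q_def by (simp add: coeff_mult_0 coeff_0_power)
    then obtain h where h: "r = pCons 0 h"
      by (metis coeff_pCons_0 pCons_cases)
    have h_sym: "poly h x = x ^ (d - 2) * poly h (1 / x)" if "x \<noteq> 0" for x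
    proof -
      have "poly r x = x ^ d * poly r (1 / x)"
        unfolding r_def using less.prems[OF that] q_sym[OF that] by (simp add: algebra_simps)
      \<comment> \<open>One factor \<open>x\<close> cancels against \<open>r = x * h\<close> on the
        left, the other against the factor \<open>1 / x\<close> in
        \<open>poly r (1 / x)\<close>.\<close>
      moreover have "x ^ d = x ^ (d - 2) * x * x"
        using 3 by (metis le_add_diff_inverse2 mult.assoc power2_eq_square power_add)
      ultimately show ?thesis using that by (simp add: h)
    qed
    have "d - 2 < d" using 3 by simp
    from less.IH[OF this h_sym, unfolded N] obtain g where
      g: "h = [:1, 1:] ^ e * (\<Sum>k=0..N. smult (g k) ([:0, 1:] ^ k * [:1, 0, 1:] ^ (N - k)))"
      by blast
    \<comment> \<open>Multiplying \<open>h\<close> by \<open>x\<close> raises every \<open>k\<close>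
      by one and leaves the exponent \<open>N - k = Suc N - Suc k\<close> alone, so the old
      coefficients shift up and the subtracted multiple fills index 0.\<close>
    define g' where "g' k = (case k of 0 \<Rightarrow> coeff f 0 | Suc j \<Rightarrow> g j)" for k
    have "f = smult (coeff f 0) q + [:0, 1:] * h"
      using h unfolding r_def by (simp add: algebra_simps)
    also have "\<dots> = [:1, 1:] ^ e * (smult (coeff f 0) ([:1, 0, 1:] ^ Suc N) +
       (\<Sum>k=0..N. smult (g k) ([:0, 1:] ^ Suc k * [:1, 0, 1:] ^ (N - k))))"
      unfolding q_def g
      by (simp only: distrib_left sum_distrib_left mult_smult_right mult_smult_left power_Suc mult_ac)
    also have "smult (coeff f 0) ([:1, 0, 1:] ^ Suc N) +
       (\<Sum>k=0..N. smult (g k) ([:0, 1:] ^ Suc k * [:1, 0, 1:] ^ (N - k)))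
      = (\<Sum>k=0..Suc N. smult (g' k) ([:0, 1:] ^ k * [:1, 0, 1:] ^ (Suc N - k)))"
      by (subst sum.atLeast0_atMost_Suc_shift) (simp add: g'_def)
    finally show ?thesis unfolding N_Suc e_def by blast
  qed
qed

section \<open>The substitution w = x + 1/x\<close>

text \<open>Since \<open>1 + x * x = x * w\<close>, the basis polynomial of index \<open>k\<close>
  equals \<open>x ^ N * w ^ (N - k)\<close>; hence the gamma coefficients appear in \<open>G\<close>
  in reversed order.\<close>

lemma symmetric_poly_reduction:
  fixes f :: "real poly"
  assumes sym: "symmetric_poly f" and "f \<noteq> 0"
    and N_def: "N = degree f div 2" and e_def: "e = degree f mod 2"
  obtains G :: "real poly" where
    "f = [:1, 1:] ^ e *
       (\<Sum>k=0..N. smult (coeff G (N - k)) ([:0, 1:] ^ k * [:1, 0, 1:] ^ (N - k)))"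
    "degree G = N" "lead_coeff G = lead_coeff f"
    "\<And>x. x \<noteq> 0 \<Longrightarrow>
       poly (cpoly f) x = (1 + x) ^ e * x ^ N * poly (cpoly G) (x + 1 / x)"
proof -
  have "\<And>x. x \<noteq> 0 \<Longrightarrow> poly f x = x ^ degree f * poly f (1 / x)"
    using sym unfolding symmetric_poly_def by blast
  from palindromic_gamma_expansion[OF this] obtain g where
    f: "f = [:1, 1:] ^ e * (\<Sum>k=0..N. smult (g k) ([:0, 1:] ^ k * [:1, 0, 1:] ^ (N - k)))"
    unfolding N_def e_def by blast
  define G where "G = (\<Sum>k=0..N. monom (g k) (N - k))"
  have coeff_G: "coeff G (N - j) = g j" if "j \<le> N" for j
  proof -
    have "coeff G (N - j) = (\<Sum>k=0..N. if k = j then g k else 0)"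
      unfolding G_def coeff_sum using that by (intro sum.cong) auto
    then show ?thesis using that by (simp add: sum.delta)
  qed
  \<comment> \<open>At 0 only the term \<open>k = 0\<close> survives, so \<open>g 0\<close> is the
    constant term, which equals the leading coefficient by symmetry. This makes the degree of
    \<open>G\<close> exactly \<open>N\<close>.\<close>
  have "coeff f 0 = poly f 0" by (simp add: poly_0_coeff_0)
  also have "poly f 0 = (\<Sum>k=0..N. g k * 0 ^ k)"
    by (subst f) (simp add: poly_sum)
  also have "\<dots> = (\<Sum>k=0..N. if k = 0 then g k else 0)"
    by (intro sum.cong) auto
  finally have g0: "g 0 = lead_coeff f"
    using symmetric_poly_coeff_0[OF sym] by (simp add: sum.delta)
  have "degree G \<le> N"
    unfolding G_def by (intro degree_sum_le) (auto intro: order_trans[OF degree_monom_le])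
  moreover have "coeff G N = lead_coeff f"
    using coeff_G[of 0] g0 by simp
  moreover from this have "coeff G N \<noteq> 0" using \<open>f \<noteq> 0\<close> by simp
  ultimately have deg: "degree G = N"
    using le_degree le_antisym by blast
  have eval: "poly (cpoly f) x = (1 + x) ^ e * x ^ N * poly (cpoly G) (x + 1 / x)"
    if "x \<noteq> 0" for x
  proof -
    have q: "1 + x * x = x * (x + 1 / x)" using that by (simp add: field_simps)
    have "poly (cpoly f) x = (1 + x) ^ e *
      (\<Sum>k=0..N. of_real (g k) * (x ^ k * (1 + x * x) ^ (N - k)))"
      by (subst f) (simp add: cpoly_mult cpoly_power cpoly_sum cpoly_smult map_poly_pCons poly_sum)
    also have "(\<Sum>k=0..N. of_real (g k) * (x ^ k * (1 + x * x) ^ (N - k)))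
      = (\<Sum>k=0..N. x ^ N * (of_real (g k) * (x + 1 / x) ^ (N - k)))"
    proof (rule sum.cong)
      fix k assume "k \<in> {0..N}"
      then have "x ^ N = x ^ k * x ^ (N - k)" by (simp flip: power_add)
      then show "of_real (g k) * (x ^ k * (1 + x * x) ^ (N - k)) =
        x ^ N * (of_real (g k) * (x + 1 / x) ^ (N - k))"
        unfolding q power_mult_distrib by (simp only: mult_ac)
    qed simp
    also have "\<dots> = x ^ N * poly (cpoly G) (x + 1 / x)"
      unfolding G_def by (simp add: cpoly_sum map_poly_monom poly_sum poly_monom sum_distrib_left)
    finally show ?thesis by (simp only: mult.assoc)
  qed
  show thesis
  proof (rule that[of G])
    show "f = [:1, 1:] ^ e * (\<Sum>k=0..N. smult (coeff G (N - k)) ([:0, 1:] ^ k * [:1, 0, 1:] ^ (N - k)))"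
      by (subst f) (simp add: coeff_G)
  qed (use deg eval \<open>coeff G N = lead_coeff f\<close> in auto)
qed

lemma Re_add_inverse_pos:
  assumes "Re x > 0"
  shows "Re (x + 1 / x) > 0"
proof -
  have "Re (1 / x) = Re x / (cmod x)\<^sup>2"
    by (simp add: Re_divide cmod_power2)
  then show ?thesis using assms by (simp add: add_pos_nonneg)
qed

text \<open>Either root of \<open>x * x - w * x + 1\<close> serves: the real part of
  \<open>w\<close> is that of \<open>x\<close> times a positive number. This surjectivity is what
  carries stability from \<open>f\<close> to \<open>G\<close>.\<close>

lemma ex_add_inverse_eq:
  assumes "Re w > 0"
  obtains x where "Re x > 0" "x + 1 / x = w"
proof -
  define x where "x = w / 2 + csqrt (w\<^sup>2 - 4) / 2"
  have "2 * x - w = csqrt (w\<^sup>2 - 4)" by (simp add: x_def)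
  then have "(2 * x - w)\<^sup>2 = w\<^sup>2 - 4" by simp
  then have "4 * (x * x + 1) = 4 * (w * x)" by (simp add: power2_eq_square algebra_simps)
  then have eq: "x * x + 1 = w * x" by (simp only: mult_cancel_left) simp
  then have "x \<noteq> 0" by auto
  with eq have w: "x + 1 / x = w" by (simp add: field_simps)
  have "Re (1 / x) = Re x / (cmod x)\<^sup>2"
    by (simp add: Re_divide cmod_power2)
  then have "Re w = Re x * (1 + 1 / (cmod x)\<^sup>2)"
    using w by (auto simp: algebra_simps)
  moreover have "1 + 1 / (cmod x)\<^sup>2 > 0" by (simp add: add_pos_nonneg)
  ultimately have "Re x > 0" using assms by (simp add: zero_less_mult_iff)
  with w that show thesis by blast
qed

section \<open>Stable real polynomials and semi-gamma-positivity\<close>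

text \<open>One monic real factor is split off at a time: linear for a real zero \<open>z\<close>,
  quadratic for a conjugate pair. As \<open>Re z \<le> 0\<close>, its coefficients are nonnegative,
  and products preserve this.\<close>

lemma real_stable_coeff_nonneg:
  fixes G :: "real poly"
  assumes "\<And>w. Re w > 0 \<Longrightarrow> poly (cpoly G) w \<noteq> 0" and "lead_coeff G \<ge> 0"
  shows "coeff G k \<ge> 0"
  using assms
proof (induction "degree G" arbitrary: G k rule: less_induct)
  case (less G)
  show ?case
  proof (cases "degree G = 0")
    case True
    then obtain a where "G = [:a:]" by (rule degree_eq_zeroE)
    with less.prems show ?thesis by (simp add: coeff_pCons split: nat.splits)
  next
    case False
    then have "\<not> constant (poly (cpoly G))" by (simp add: constant_degree)
    then obtain z where z: "poly (cpoly G) z = 0"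
      using fundamental_theorem_of_algebra by blast
    then have Re_z: "Re z \<le> 0" using less.prems(1)[of z] by force
    obtain q where q: "q dvd G" "degree q > 0" "lead_coeff q = 1" "\<And>i. coeff q i \<ge> 0"
    proof (cases "Im z = 0")
      case True
      then have "complex_of_real (poly G (Re z)) = 0"
        using z by (simp add: poly_cpoly_of_real[symmetric] complex_is_Real_iff of_real_Re)
      then have "[:- Re z, 1:] dvd G" by (simp add: poly_eq_0_iff_dvd)
      then show thesis
        using Re_z by (intro that[of "[:- Re z, 1:]"]) (auto simp: coeff_pCons split: nat.splits)
    next
      case False
      define q where "q = [:(Re z)\<^sup>2 + (Im z)\<^sup>2, - 2 * Re z, 1:]"
      have "poly (cpoly q) z = 0"
        by (rule complex_eqI)
          (simp_all add: q_def map_poly_pCons power2_eq_square algebra_simps)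
      moreover have "G = q * (G div q) + G mod q" by simp
      then have "poly (cpoly G) z =
          poly (cpoly q) z * poly (cpoly (G div q)) z + poly (cpoly (G mod q)) z"
        by (metis cpoly_add cpoly_mult poly_add poly_mult)
      ultimately have r: "poly (cpoly (G mod q)) z = 0" using z by simp
      \<comment> \<open>A real polynomial of degree below 2 that vanishes at a non-real point is
        zero, so \<open>q\<close> divides \<open>G\<close> already over the reals.\<close>
      have "degree (G mod q) < 2"
        using degree_mod_less'[of q G] by (cases "G mod q = 0") (simp_all add: q_def)
      then have "G mod q = [:coeff (G mod q) 0, coeff (G mod q) 1:]"
        by (intro poly_eqI) (auto simp: coeff_pCons coeff_eq_0 split: nat.splits)
      then obtain a b where ab: "G mod q = [:a, b:]" by blast
      have "of_real a + z * of_real b = 0"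
        using r by (simp add: ab map_poly_pCons)
      with False have "b = 0" "a = 0" by (auto simp: complex_eq_iff)
      then have "q dvd G" using ab by (simp add: mod_eq_0_iff_dvd)
      then show thesis
        using Re_z by (intro that[of q]) (auto simp: q_def coeff_pCons split: nat.splits)
    qed
    obtain H where H: "G = q * H" using q(1) by blast
    have "H \<noteq> 0" "q \<noteq> 0" using False H by auto
    then have "degree H < degree G" using q(2) by (simp add: H degree_mult_eq)
    moreover have "poly (cpoly H) w \<noteq> 0" if "Re w > 0" for w
      using less.prems(1)[OF that] by (simp add: H cpoly_mult)
    moreover have "lead_coeff H \<ge> 0"
      using less.prems(2) q(3) by (simp add: H lead_coeff_mult)
    ultimately have "coeff H i \<ge> 0" for i by (rule less.hyps)
    then show ?thesis unfolding H coeff_mult using q(4) by (intro sum_nonneg) simp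
  qed
qed

text \<open>A zero \<open>w\<close> of \<open>q\<close> lifts to some \<open>x\<close> in the right
  half-plane, where \<open>p\<close> would vanish too. The function \<open>c\<close> stands for the
  prefactor \<open>(1 + x) ^ e * x ^ N\<close>.\<close>

lemma hurwitz_stable_reduction:
  assumes stable: "hurwitz_stable p" and "p \<noteq> 0"
    and eval: "\<And>x. x \<noteq> 0 \<Longrightarrow> poly p x = c x * poly q (x + 1 / x)"
    and w: "Re w > 0"
  shows "poly q w \<noteq> 0"
proof -
  obtain x where x: "Re x > 0" "x + 1 / x = w" using ex_add_inverse_eq[OF w] .
  then have "poly p x \<noteq> 0"
    using stable \<open>p \<noteq> 0\<close> unfolding hurwitz_stable_def by blast
  moreover have "x \<noteq> 0" using x(1) by auto
  ultimately show ?thesis using eval[of x] x(2) by auto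
qed

lemma stable_symmetric_semi_gamma_positive:
  fixes f :: "real poly"
  assumes sym: "symmetric_poly f" and pos: "lead_coeff f > 0"
    and stable: "hurwitz_stable (cpoly f)"
  shows "semi_gamma_positive f"
proof -
  have nz: "f \<noteq> 0" using pos by auto
  define N where "N = degree f div 2"
  define e where "e = degree f mod 2"
  obtain G where
    f: "f = [:1, 1:] ^ e *
       (\<Sum>k=0..N. smult (coeff G (N - k)) ([:0, 1:] ^ k * [:1, 0, 1:] ^ (N - k)))"
    and "degree G = N" and lc: "lead_coeff G = lead_coeff f"
    and eval: "\<And>x. x \<noteq> 0 \<Longrightarrow>
       poly (cpoly f) x = (1 + x) ^ e * x ^ N * poly (cpoly G) (x + 1 / x)"
    using symmetric_poly_reduction[OF sym nz N_def e_def] by blast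
  have "poly (cpoly G) w \<noteq> 0" if "Re w > 0" for w
    using hurwitz_stable_reduction[OF stable _ eval that] nz by simp
  then have "coeff G i \<ge> 0" for i
    using real_stable_coeff_nonneg pos lc by simp
  with sym show ?thesis
    unfolding semi_gamma_positive_def Let_def N_def[symmetric] e_def[symmetric]
    by (intro conjI exI[of _ "\<lambda>k. coeff G (N - k)"] f allI impI)
qed

text \<open>Every basis polynomial is nonnegative there. Applied at \<open>x = 1\<close>, this
  controls the sign of the leading coefficient along the recurrence.\<close>

lemma semi_gamma_positive_poly_nonneg:
  assumes "semi_gamma_positive f" and "x \<ge> 0"
  shows "poly f x \<ge> 0"
proof -
  obtain g where f: "f = [:1, 1:] ^ (degree f mod 2) * (\<Sum>k=0..degree f div 2.
       smult (g k) ([:0, 1:] ^ k * [:1, 0, 1:] ^ (degree f div 2 - k)))"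
    and g: "\<And>k. k \<le> degree f div 2 \<Longrightarrow> g k \<ge> 0"
    using assms(1) unfolding semi_gamma_positive_def Let_def by blast
  show ?thesis
    by (subst f) (auto simp: poly_sum g assms(2) intro!: mult_nonneg_nonneg sum_nonneg)
qed

section \<open>Logarithmic derivatives of stable polynomials\<close>

text \<open>For \<open>Re s \<le> 0 < a = Re w\<close> the number \<open>1 / (w - s)\<close> lies in the disc with centre and
  radius \<open>1 / (2a)\<close>; a sum of \<open>n\<close> such numbers lies in the \<open>n\<close>-fold dilation of that disc.\<close>

lemma inverse_diff_in_disc:
  assumes "Re w > 0" "Re s \<le> 0"
  shows "cmod (2 * of_real (Re w) / (w - s) - 1) \<le> 1"
proof -
  have nz: "w - s \<noteq> 0" using assms by auto
  have "2 * of_real (Re w) / (w - s) - 1 = (s - cnj (- w)) / (w - s)"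
    using nz by (simp add: field_simps complex_add_cnj)
  \<comment> \<open>The two sides are squared distances from \<open>s\<close> to
    \<open>- cnj w\<close> and to \<open>w\<close>, which are mirror images in the imaginary axis;
    \<open>s\<close> lies on the side of \<open>- cnj w\<close>.\<close>
  moreover have "(cmod (s + cnj w))\<^sup>2 \<le> (cmod (w - s))\<^sup>2"
    unfolding cmod_power2 using mult_nonneg_nonpos[of "Re w" "Re s"] assms
    by (simp add: power2_eq_square algebra_simps)
  then have "cmod (s + cnj w) \<le> cmod (w - s)"
    by (rule power2_le_imp_le) simp
  ultimately show ?thesis using nz by (simp add: norm_divide)
qed

lemma log_deriv_in_disc:
  assumes w: "Re w > 0" and "\<And>z. Re z > 0 \<Longrightarrow> poly p z \<noteq> 0"
  shows "cmod (2 * of_real (Re w) * (poly (pderiv p) w / poly p w) - of_nat (degree p))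
    \<le> real (degree p)"
  using assms(2)
proof (induction "degree p" arbitrary: p)
  case 0
  then have "pderiv p = 0" by (simp add: pderiv_eq_0_iff)
  with 0 show ?case by simp
next
  case (Suc n)
  then have "\<not> constant (poly p)" by (simp add: constant_degree)
  then obtain s where s: "poly p s = 0"
    using fundamental_theorem_of_algebra by blast
  then have Re_s: "Re s \<le> 0" using Suc.prems[of s] by force
  from s obtain q where q: "p = [:- s, 1:] * q"
    using poly_eq_0_iff_dvd by blast
  have "q \<noteq> 0" using Suc.hyps(2) q by auto
  then have deg: "degree p = Suc (degree q)" unfolding q by (subst degree_mult_eq) simp_all
  have stable: "poly q z \<noteq> 0" if "Re z > 0" for z
    using Suc.prems[OF that] by (simp add: q)
  have "w - s \<noteq> 0" "poly q w \<noteq> 0" using w Re_s stable by auto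
  \<comment> \<open>Logarithmic derivatives add over products, so the zero \<open>s\<close>
    contributes \<open>1 / (w - s)\<close>.\<close>
  then have "poly (pderiv p) w / poly p w = 1 / (w - s) + poly (pderiv q) w / poly q w"
    unfolding q pderiv_mult by (simp add: pderiv_pCons field_simps)
  then have "2 * of_real (Re w) * (poly (pderiv p) w / poly p w) - of_nat (degree p)
    = (2 * of_real (Re w) / (w - s) - 1) +
      (2 * of_real (Re w) * (poly (pderiv q) w / poly q w) - of_nat (degree q))"
    by (simp add: deg algebra_simps)
  also have "cmod \<dots> \<le> 1 + real (degree q)"
    using inverse_diff_in_disc[OF w Re_s] Suc.hyps(1)[OF _ stable] Suc.hyps(2) deg
    by (intro norm_triangle_mono) simp_all
  finally show ?case by (simp add: deg)
qed

text \<open>With \<open>w = x + 1 / x\<close>, the square of \<open>f\<close> is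
  \<open>x ^ d\<close> times \<open>(w + 2) ^ e * G(w) ^ 2\<close>, where
  \<open>d = degree f\<close>. The number \<open>v\<close> is the logarithmic derivative in
  \<open>w\<close> of this last polynomial, which has \<open>d\<close> zeros, all with nonpositive
  real part; the chain rule brings it back to \<open>x\<close>.\<close>

lemma stable_symmetric_log_deriv:
  fixes f :: "real poly"
  assumes sym: "symmetric_poly f" and nz: "f \<noteq> 0" and stable: "hurwitz_stable (cpoly f)"
    and x: "Re x > 0"
  obtains v where
    "cmod (2 * of_real (Re (x + 1 / x)) * v - of_nat (degree f)) \<le> real (degree f)"
    "2 * x\<^sup>2 * poly (pderiv (cpoly f)) x
      = (of_nat (degree f) * x + (x\<^sup>2 - 1) * v) * poly (cpoly f) x"
proof -
  define N where "N = degree f div 2"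
  define e where "e = degree f mod 2"
  have d: "degree f = 2 * N + e" and "e < 2" unfolding N_def e_def by simp_all
  obtain G where deg_G: "degree G = N" and
    eval: "\<And>x. x \<noteq> 0 \<Longrightarrow>
      poly (cpoly f) x = (1 + x) ^ e * x ^ N * poly (cpoly G) (x + 1 / x)"
    using symmetric_poly_reduction[OF sym nz N_def e_def] by blast
  have G: "poly (cpoly G) w \<noteq> 0" if "Re w > 0" for w
    using hurwitz_stable_reduction[OF stable _ eval that] nz by simp
  define w where "w = x + 1 / x"
  have w: "Re w > 0" unfolding w_def by (rule Re_add_inverse_pos[OF x])
  have x0: "x \<noteq> 0" "1 + x \<noteq> 0" using x by (auto simp: complex_eq_iff)
  have w2: "w + 2 = (1 + x)\<^sup>2 / x"
    using x0 by (simp add: w_def power2_eq_square field_simps)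
  define \<gamma> where "\<gamma> = poly (pderiv (cpoly G)) w / poly (cpoly G) w"
  define v where "v = 2 * \<gamma> + of_nat e / (w + 2)"
  show thesis
  proof (rule that)
    have "cmod (of_nat e * (2 * of_real (Re w) / (w - (- 2)) - 1)) \<le> real e * 1"
      unfolding norm_mult norm_of_nat
      by (intro mult_left_mono inverse_diff_in_disc w) simp_all
    moreover have "cmod (2 * of_real (Re w) * \<gamma> - of_nat N) \<le> real N"
      using log_deriv_in_disc[OF w G] deg_G by (simp add: \<gamma>_def)
    then have "cmod (2 * (2 * of_real (Re w) * \<gamma> - of_nat N)) \<le> 2 * real N"
      unfolding norm_mult by simp
    ultimately have "cmod (2 * (2 * of_real (Re w) * \<gamma> - of_nat N) +
        of_nat e * (2 * of_real (Re w) / (w - (- 2)) - 1)) \<le> 2 * real N + real e"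
      by (intro norm_triangle_mono) simp_all
    then show "cmod (2 * of_real (Re (x + 1 / x)) * v - of_nat (degree f)) \<le> real (degree f)"
      unfolding d v_def w_def[symmetric] by (simp add: algebra_simps)
  next
    define A where "A = (\<lambda>x::complex. (1 + x) ^ e)"
    define B where "B = (\<lambda>x::complex. x ^ N)"
    define P where "P = (\<lambda>x. poly (cpoly G) (x + 1 / x))"
    \<comment> \<open>For \<open>e = 0\<close> the truncated exponent \<open>e - 1\<close> is
      harmless, as both sides vanish; likewise for \<open>N\<close> below.\<close>
    have "of_nat e * (1 + x) ^ (e - 1) = of_nat e / (1 + x) * A x"
      using x0(2) unfolding A_def by (cases e) simp_all
    then have DA: "(A has_field_derivative of_nat e / (1 + x) * A x) (at x)"
      unfolding A_def by (auto intro!: derivative_eq_intros)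
    have "of_nat N * x ^ (N - 1) = of_nat N / x * B x"
      using x0(1) unfolding B_def by (cases N) simp_all
    then have DB: "(B has_field_derivative of_nat N / x * B x) (at x)"
      unfolding B_def by (auto intro!: derivative_eq_intros)
    have "((\<lambda>x. x + 1 / x) has_field_derivative 1 - 1 / x\<^sup>2) (at x)"
      using x0(1) by (auto intro!: derivative_eq_intros simp: power2_eq_square)
    from DERIV_chain2[OF poly_DERIV this, of "cpoly G"]
    have DP: "(P has_field_derivative \<gamma> * (1 - 1 / x\<^sup>2) * P x) (at x)"
      using G[OF w] unfolding P_def \<gamma>_def w_def by (simp add: mult_ac)
    let ?L = "of_nat e / (1 + x) + of_nat N / x + \<gamma> * (1 - 1 / x\<^sup>2)"
    have D: "((\<lambda>x. A x * B x * P x) has_field_derivative ?L * (A x * B x * P x)) (at x)"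
      using DERIV_mult[OF DERIV_mult[OF DA DB] DP] by (simp add: algebra_simps)
    \<comment> \<open>The factorization holds only away from 0, so it is differentiated as an
      identity near \<open>x\<close>.\<close>
    have "eventually (\<lambda>y. y \<noteq> 0) (nhds x)"
      using x0(1) by (rule t1_space_nhds)
    then have ev: "eventually (\<lambda>y. poly (cpoly f) y = A y * B y * P y) (nhds x)"
      unfolding A_def B_def P_def by eventually_elim (rule eval)
    have fx: "poly (cpoly f) x = A x * B x * P x"
      using ev by (rule eventually_nhds_x_imp_x)
    have "(poly (cpoly f) has_field_derivative ?L * poly (cpoly f) x) (at x)"
      unfolding fx DERIV_cong_ev[OF refl ev refl] by (rule D)
    then have "poly (pderiv (cpoly f)) x = ?L * poly (cpoly f) x"
      using poly_DERIV DERIV_unique by blast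
    moreover have "2 * x\<^sup>2 * ?L = of_nat (degree f) * x + (x\<^sup>2 - 1) * v"
    proof -
      have "2 * x\<^sup>2 * (of_nat e / (1 + x)) = of_nat e * x + (x\<^sup>2 - 1) * (of_nat e * x / (1 + x)\<^sup>2)"
        using x0 by (simp add: divide_simps) (simp add: power2_eq_square algebra_simps)
      moreover have "2 * x\<^sup>2 * (of_nat N / x + \<gamma> * (1 - 1 / x\<^sup>2)) = 2 * of_nat N * x + (x\<^sup>2 - 1) * (2 * \<gamma>)"
        using x0 by (simp add: power2_eq_square field_simps)
      ultimately show ?thesis unfolding v_def w2 d
        by (simp add: algebra_simps)
    qed
    ultimately show "2 * x\<^sup>2 * poly (pderiv (cpoly f)) x
      = (of_nat (degree f) * x + (x\<^sup>2 - 1) * v) * poly (cpoly f) x"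
      by (simp only: mult.assoc[symmetric])
  qed
qed

section \<open>Stability along the recurrence\<close>

text \<open>The bilinear equation expresses \<open>- w\<close> as a Moebius transform of \<open>z = d / v - w\<close> that
  preserves the right half-plane, which contradicts \<open>Re w > 0\<close> unless it degenerates.\<close>

lemma disc_bilinear_eq:
  fixes B K M d :: real
  assumes w: "Re w > 0" and v: "cmod (2 * of_real (Re w) * v - of_real d) \<le> d"
    and B: "B \<ge> 0" and K: "K \<ge> 0" and M: "K \<le> M" and d: "d \<ge> 0"
    and eq: "2 * of_real B + of_real (d * M) * w = (of_real M * w + of_real K) * (w - 2) * v"
  shows "B = 0 \<and> d * M = 0"
proof -
  \<comment> \<open>Squaring the disc condition gives a form that, for \<open>v \<noteq> 0\<close>,
    says that \<open>d / v\<close> has real part at least \<open>Re w\<close>.\<close>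
  have disc: "Re w * (cmod v)\<^sup>2 \<le> d * Re v"
  proof -
    have "(cmod (2 * of_real (Re w) * v - of_real d))\<^sup>2 \<le> d\<^sup>2"
      using v by (intro power_mono) auto
    then have "4 * Re w * (Re w * (cmod v)\<^sup>2) \<le> 4 * Re w * (d * Re v)"
      unfolding cmod_power2 by (simp add: power2_eq_square algebra_simps)
    then show ?thesis by (rule mult_left_le_imp_le) (use w in simp)
  qed
  show ?thesis
  proof (cases "v = 0")
    case True
    then have "2 * B + d * M * Re w = 0"
      using arg_cong[OF eq, of Re] by simp
    moreover have "d * M * Re w \<ge> 0" using d K M w by simp
    ultimately have "B = 0" "d * M * Re w = 0" using B by linarith+
    then show ?thesis using w by simp
  next
    case False
    define z where "z = of_real d / v - w"
    have vz: "v * (w + z) = of_real d" using False by (simp add: z_def)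
    have Re_z: "Re z \<ge> 0"
    proof -
      have "Re (of_real d / v) = d * Re v / (cmod v)\<^sup>2"
        by (simp add: Re_divide cmod_power2)
      also have "\<dots> \<ge> Re w" using disc False by (simp add: pos_le_divide_eq)
      finally show ?thesis by (simp add: z_def)
    qed
    \<comment> \<open>After multiplication by \<open>w + z\<close> and
      \<open>v * (w + z) = d\<close>, the terms in \<open>w * w\<close> cancel; \<open>Q\<close> is
      the factor of \<open>w\<close> in what remains.\<close>
    define c where "c = 2 * B + d * (2 * M - K)"
    define Q where "Q = of_real c + of_real (d * M) * z"
    have "(2 * of_real B + of_real (d * M) * w) * (w + z)
        = (of_real M * w + of_real K) * (w - 2) * (v * (w + z))"
      unfolding eq by (simp only: mult.assoc)
    then have "w * Q = - (of_real (2 * B) * z + of_real (2 * d * K))"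
      unfolding vz Q_def c_def by (simp add: algebra_simps)
    \<comment> \<open>Multiplying by \<open>cnj Q\<close> isolates \<open>Re w\<close> times a
      squared modulus on the left, while the real part on the right is minus a sum of nonnegative
      terms. Hence \<open>Q = 0\<close>.\<close>
    then have "w * Q * cnj Q = - ((of_real (2 * B) * z + of_real (2 * d * K)) * cnj Q)"
      by (simp only: mult_minus_left)
    then have "Re (w * (Q * cnj Q)) = - Re ((of_real (2 * B) * z + of_real (2 * d * K)) * cnj Q)"
      by (simp only: mult.assoc uminus_complex.sel)
    moreover have "Re (w * (Q * cnj Q)) = Re w * (cmod Q)\<^sup>2"
      by (simp add: complex_norm_square[symmetric] del: of_real_power)
    \<comment> \<open>Because \<open>K \<le> M\<close>, the constant \<open>c\<close> dominates both
      \<open>d * M\<close> and \<open>2 * B\<close>, so \<open>c = 0\<close> will force both to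
      vanish.\<close>
    moreover have c: "c \<ge> 0" "d * M \<le> c" "2 * B \<le> c"
    proof -
      have "c = 2 * B + 2 * (d * M) - d * K" by (simp add: c_def algebra_simps)
      with B mult_left_mono[OF M d] mult_nonneg_nonneg[OF d K]
      show "c \<ge> 0" "d * M \<le> c" "2 * B \<le> c" by linarith+
    qed
    moreover have "Re ((of_real (2 * B) * z + of_real (2 * d * K)) * cnj Q)
      = 2 * B * (d * M) * (cmod z)\<^sup>2 + 2 * B * c * Re z + 2 * d * K * (d * M) * Re z + 2 * d * K * c"
      unfolding Q_def cmod_power2 by (simp add: power2_eq_square algebra_simps)
    moreover have "\<dots> \<ge> 0"
      using B K M d c Re_z by simp
    ultimately have "Re w * (cmod Q)\<^sup>2 \<le> 0" by linarith
    then have "Q = 0" using w by (simp add: mult_le_0_iff)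
    then have "c + d * M * Re z = 0"
      unfolding Q_def by (metis Re_complex_of_real plus_complex.sel(1) times_complex.sel(1)
          Im_complex_of_real mult_zero_left diff_zero zero_complex.sel(1))
    moreover have "d * M * Re z \<ge> 0" using d K M Re_z by simp
    ultimately have "c = 0" using c(1) by linarith
    moreover have "d * M \<ge> 0" using d K M by simp
    ultimately show ?thesis using c B by linarith
  qed
qed

text \<open>A zero in the right half-plane gives the bilinear equation with \<open>B\<close>,
  \<open>K\<close>, \<open>M\<close> as below; the sign hypotheses are exactly
  \<open>B \<ge> 0\<close> and \<open>0 \<le> K \<le> M\<close>. Its degenerate solution makes the
  new polynomial zero, which counts as stable.\<close>

lemma recurrence_stable:
  fixes f :: "real poly" and \<beta> \<mu> \<nu> :: real
  assumes sym: "symmetric_poly f" and nz: "f \<noteq> 0" and stable: "hurwitz_stable (cpoly f)"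
    and d_def: "d = real (degree f)"
    and \<nu>: "0 \<le> \<nu>" and \<mu>\<nu>: "\<mu> + \<nu> \<le> 0" and \<beta>: "2 * \<beta> + d * (\<mu> + \<nu>) \<ge> 0"
  shows "hurwitz_stable (cpoly
    ([: \<beta> + d * \<nu>, \<beta>, - d * \<mu> :] * f + [: - \<mu>, - \<nu>, \<nu>, \<mu> :] * pderiv f))"
    (is "hurwitz_stable (cpoly ?h)")
proof (cases "?h = 0")
  case False
  have "poly (cpoly ?h) x \<noteq> 0" if x: "Re x > 0" for x
  proof
    assume h0: "poly (cpoly ?h) x = 0"
    define w where "w = x + 1 / x"
    define F where "F = poly (cpoly f) x"
    define D where "D = poly (pderiv (cpoly f)) x"
    obtain v where v: "cmod (2 * of_real (Re w) * v - of_real d) \<le> d"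
      and D: "2 * x\<^sup>2 * D = (of_real d * x + (x\<^sup>2 - 1) * v) * F"
      using stable_symmetric_log_deriv[OF sym nz stable x]
      unfolding w_def d_def D_def F_def of_real_of_nat_eq by blast
    have x0: "x \<noteq> 0" "1 + x \<noteq> 0" using x by (auto simp: complex_eq_iff)
    have w: "Re w > 0" unfolding w_def by (rule Re_add_inverse_pos[OF x])
    have "F \<noteq> 0" using stable nz x unfolding F_def hurwitz_stable_def by simp
    define p where "p = of_real (\<beta> + d * \<nu>) + of_real \<beta> * x - of_real (d * \<mu>) * x\<^sup>2"
    define q where "q = - of_real \<mu> - of_real \<nu> * x + of_real \<nu> * x\<^sup>2 + of_real \<mu> * x ^ 3"
    define B where "B = \<beta> + d * (\<mu> + \<nu>) / 2"
    define M where "M = - \<mu>"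
    define K where "K = - (\<mu> + \<nu>)"
    have "poly (cpoly [: \<beta> + d * \<nu>, \<beta>, - d * \<mu> :]) x = p"
      "poly (cpoly [: - \<mu>, - \<nu>, \<nu>, \<mu> :]) x = q"
      unfolding p_def q_def
      by (simp_all add: map_poly_pCons power2_eq_square power3_eq_cube algebra_simps)
    then have "p * F + q * D = 0"
      using h0 unfolding F_def D_def cpoly_add cpoly_mult cpoly_pderiv poly_add poly_mult by simp
    then have "2 * x\<^sup>2 * p * F + q * (2 * x\<^sup>2 * D) = 0" by algebra
    then have "(2 * x\<^sup>2 * p + q * (of_real d * x + (x\<^sup>2 - 1) * v)) * F = 0"
      unfolding D by (simp only: distrib_right mult.assoc)
    with \<open>F \<noteq> 0\<close> have E: "2 * x\<^sup>2 * p + q * (of_real d * x + (x\<^sup>2 - 1) * v) = 0" by simp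
    have xw: "x * w = x\<^sup>2 + 1"
      using x0 by (simp add: w_def power2_eq_square field_simps)
    \<comment> \<open>The cubic \<open>q\<close> factors as
      \<open>- x * (x - 1) * (M * w + K)\<close>, and \<open>x * w - 2 * x\<close> is the square of
      \<open>x - 1\<close>. Clearing denominators with \<open>x * x * (1 + x)\<close> therefore
      matches the two equations.\<close>
    have "x\<^sup>2 * (1 + x) * (2 * of_real B + of_real (d * M) * w
        - (of_real M * w + of_real K) * (w - 2) * v)
      = (1 + x) * (2 * of_real B * x\<^sup>2 + of_real (d * M) * x * (x * w)
        - (of_real M * (x * w) + of_real K * x) * (x * w - 2 * x) * v)"
      by (simp add: power2_eq_square algebra_simps)
    also have "\<dots> = 2 * x\<^sup>2 * p + q * (of_real d * x + (x\<^sup>2 - 1) * v)"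
      unfolding xw p_def q_def B_def M_def K_def
      by (simp add: power2_eq_square power3_eq_cube field_simps)
    finally have "2 * of_real B + of_real (d * M) * w
        = (of_real M * w + of_real K) * (w - 2) * v"
      unfolding E using x0 by simp
    then have "B = 0 \<and> d * M = 0"
      by (rule disc_bilinear_eq[OF w v, rotated -1])
        (use \<nu> \<mu>\<nu> \<beta> in \<open>auto simp: B_def M_def K_def d_def\<close>)
    then have B0: "B = 0" and d\<mu>: "d = 0 \<or> \<mu> = 0" by (auto simp: M_def)
    \<comment> \<open>If \<mu> vanishes, the sign conditions squeeze \<nu> to 0; together with
      \<open>B = 0\<close> every term of the recurrence then disappears.\<close>
    then have "d = 0 \<or> \<mu> = 0 \<and> \<nu> = 0" using \<nu> \<mu>\<nu> by linarith
    moreover from this have "\<beta> = 0" using B0 by (auto simp: B_def)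
    moreover have "pderiv f = 0" if "d = 0"
      using that by (simp add: d_def pderiv_eq_0_iff)
    ultimately have "?h = 0" by auto
    with False show False by simp
  qed
  then show ?thesis unfolding hurwitz_stable_def by blast
qed (simp add: hurwitz_stable_def)

section \<open>Symmetry and leading coefficient along the recurrence\<close>

text \<open>This is the derivative of \<open>f(y) = y ^ d * f(1 / y)\<close> at \<open>x\<close>,
  cleared of denominators for substitution into the recurrence.\<close>

lemma symmetric_poly_pderiv:
  fixes f :: "real poly"
  assumes sym: "symmetric_poly f" and x: "x \<noteq> 0"
  shows "x ^ degree f * poly (pderiv f) (1 / x)
    = x * (real (degree f) * poly f x - x * poly (pderiv f) x)"
proof -
  define d where "d = degree f"
  have eq: "poly f y = y ^ d * poly f (1 / y)" if "y \<noteq> 0" for y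
    using sym that unfolding symmetric_poly_def d_def by blast
  have "real d * x ^ (d - 1) = real d * x ^ d / x"
    using x by (cases d) simp_all
  then have D1: "((\<lambda>y. y ^ d) has_field_derivative real d * x ^ d / x) (at x)"
    by (auto intro!: derivative_eq_intros)
  have "((\<lambda>y. 1 / y) has_field_derivative - 1 / x\<^sup>2) (at x)"
    using x by (auto intro!: derivative_eq_intros simp: power2_eq_square)
  from DERIV_chain2[OF poly_DERIV this, of f]
  have D2: "((\<lambda>y. poly f (1 / y)) has_field_derivative
    poly (pderiv f) (1 / x) * (- 1 / x\<^sup>2)) (at x)" .
  have "eventually (\<lambda>y. y \<noteq> 0) (nhds x)"
    using x by (rule t1_space_nhds)
  then have ev: "eventually (\<lambda>y. poly f y = y ^ d * poly f (1 / y)) (nhds x)"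
    by eventually_elim (rule eq)
  have "poly (pderiv f) x = real d * x ^ d / x * poly f (1 / x)
      + poly (pderiv f) (1 / x) * (- 1 / x\<^sup>2) * x ^ d"
    using poly_DERIV[of f x] DERIV_mult[OF D1 D2] DERIV_unique
    unfolding DERIV_cong_ev[OF refl ev refl] by blast
  also have "\<dots> = real d * (x ^ d * poly f (1 / x)) / x - x ^ d * poly (pderiv f) (1 / x) / x\<^sup>2"
    by (simp add: mult_ac)
  also have "x ^ d * poly f (1 / x) = poly f x" using eq[OF x] by simp
  finally show ?thesis
    using x unfolding d_def[symmetric] by (simp add: power2_eq_square field_simps)
qed

text \<open>The cubic factor is antisymmetric under reversal. The extra \<open>d * F\<close> from
  the reversed derivative then turns the reversed quadratic factor back into the original
  one.\<close>

lemma recurrence_symmetric: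
  fixes f :: "real poly" and \<beta> \<mu> \<nu> :: real
  assumes sym: "symmetric_poly f" and d_def: "d = real (degree f)"
    and h: "h = [: \<beta> + d * \<nu>, \<beta>, - d * \<mu> :] * f + [: - \<mu>, - \<nu>, \<nu>, \<mu> :] * pderiv f"
    and deg: "degree h = degree f + 1"
  shows "symmetric_poly h"
  unfolding symmetric_poly_def
proof (intro allI impI)
  fix x :: real
  assume x: "x \<noteq> 0"
  define F where "F = poly f x"
  define D where "D = poly (pderiv f) x"
  have F: "x ^ degree f * poly f (1 / x) = F"
    using sym x unfolding symmetric_poly_def F_def by metis
  have D: "x ^ degree f * poly (pderiv f) (1 / x) = x * (d * F - x * D)"
    unfolding F_def D_def d_def by (rule symmetric_poly_pderiv[OF sym x])
  have "poly h (1 / x) = (\<beta> + d * \<nu> + \<beta> / x - d * \<mu> / x\<^sup>2) * poly f (1 / x)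
      + (- \<mu> - \<nu> / x + \<nu> / x\<^sup>2 + \<mu> / x ^ 3) * poly (pderiv f) (1 / x)"
    unfolding h by (simp add: power2_eq_square power3_eq_cube algebra_simps add_divide_distrib)
  then have "x ^ degree h * poly h (1 / x)
    = x * ((\<beta> + d * \<nu> + \<beta> / x - d * \<mu> / x\<^sup>2) * (x ^ degree f * poly f (1 / x))
      + (- \<mu> - \<nu> / x + \<nu> / x\<^sup>2 + \<mu> / x ^ 3) * (x ^ degree f * poly (pderiv f) (1 / x)))"
    unfolding deg power_add power_one_right by (simp only: distrib_left mult_ac)
  also have "\<dots> = (\<beta> + d * \<nu> + \<beta> * x - d * \<mu> * x\<^sup>2) * F
      + (- \<mu> - \<nu> * x + \<nu> * x\<^sup>2 + \<mu> * x ^ 3) * D"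
    unfolding F D using x by (simp add: power2_eq_square power3_eq_cube field_simps)
  also have "\<dots> = poly h x"
    unfolding h F_def D_def by (simp add: power2_eq_square power3_eq_cube algebra_simps)
  finally show "poly h x = x ^ degree h * poly h (1 / x)" by simp
qed

text \<open>Otherwise \<open>- f\<close> would be semi-gamma-positive, hence nonnegative at 1, so
  \<open>f\<close> would vanish at 1, inside the right half-plane. The value at 1 is easier to
  follow through the recurrence than the leading coefficient.\<close>

lemma stable_symmetric_lead_coeff_pos:
  fixes f :: "real poly"
  assumes sym: "symmetric_poly f" and stable: "hurwitz_stable (cpoly f)"
    and "f \<noteq> 0" and "poly f 1 \<ge> 0"
  shows "lead_coeff f > 0"
proof (rule ccontr)
  assume "\<not> lead_coeff f > 0"
  then have "lead_coeff (- f) > 0" using \<open>f \<noteq> 0\<close> by (simp add: not_less order.strict_iff_order)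
  moreover have "symmetric_poly (- f)"
    using sym
    unfolding symmetric_poly_def degree_minus poly_minus mult_minus_right neg_equal_iff_equal .
  moreover have "cpoly (- f) = - cpoly f"
    by (rule poly_eqI) (simp add: coeff_map_poly)
  then have "hurwitz_stable (cpoly (- f))"
    using stable by (simp add: hurwitz_stable_def)
  ultimately have "semi_gamma_positive (- f)"
    by (intro stable_symmetric_semi_gamma_positive)
  then have "poly (- f) 1 \<ge> 0"
    by (rule semi_gamma_positive_poly_nonneg) simp
  with \<open>poly f 1 \<ge> 0\<close> have "poly f 1 = 0" by simp
  then have "poly (cpoly f) (of_real 1) = 0" by (simp only: poly_cpoly_of_real of_real_0)
  then show False using stable \<open>f \<noteq> 0\<close> by (auto simp: hurwitz_stable_def)
qed

section \<open>Induction over the sequence\<close>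

theorem theorem4p6:
  fixes T :: "nat \<Rightarrow> real poly"
    and m :: "nat \<Rightarrow> nat"
    and \<beta> \<mu> \<nu> :: "nat \<Rightarrow> real"
  assumes deg: "\<And>n. degree (T n) = m n"
    and m_Suc: "\<And>n. m (Suc n) = m n + 1"
    and rec: "\<And>n. T (Suc n) =
        [: \<beta> n + real (m n) * \<nu> n, \<beta> n, - real (m n) * \<mu> n :] * T n
        + [: - \<mu> n, - \<nu> n, \<nu> n, \<mu> n :] * pderiv (T n)"
    and mu_nonpos: "\<And>n. \<mu> n \<le> 0"
    and nu_nonneg: "\<And>n. 0 \<le> \<nu> n"
    and T0_sym: "symmetric_poly (T 0)"
    and T0_lead: "lead_coeff (T 0) > 0"
    and T0_stable: "hurwitz_stable (map_poly complex_of_real (T 0))"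
    and mu_nu: "\<And>n. \<mu> n + \<nu> n \<le> 0"
    and beta: "\<And>n. 2 * \<beta> n + real (m n) * (\<mu> n + \<nu> n) \<ge> 0"
  shows "\<forall>n. hurwitz_stable (map_poly complex_of_real (T n)) \<and> semi_gamma_positive (T n)"
proof
  fix n
  \<comment> \<open>The invariant carries the sign of the leading coefficient; semi-gamma-positivity
    follows from it at each \<open>n\<close>.\<close>
  have "symmetric_poly (T n) \<and> hurwitz_stable (cpoly (T n)) \<and> lead_coeff (T n) > 0"
  proof (induction n)
    case 0
    show ?case using T0_sym T0_stable T0_lead by blast
  next
    case (Suc n)
    then have sym: "symmetric_poly (T n)" and stable: "hurwitz_stable (cpoly (T n))"
      and pos: "lead_coeff (T n) > 0" by blast+
    then have nz: "T n \<noteq> 0" by auto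
    have d: "real (m n) = real (degree (T n))" by (simp add: deg)
    have sym': "symmetric_poly (T (Suc n))"
      by (rule recurrence_symmetric[OF sym d rec]) (simp add: deg m_Suc)
    have stable': "hurwitz_stable (cpoly (T (Suc n)))"
      unfolding rec by (rule recurrence_stable[OF sym nz stable d nu_nonneg mu_nu beta])
    have nz': "T (Suc n) \<noteq> 0"
      using deg[of "Suc n"] by (auto simp: m_Suc)
    have "poly (T n) 1 \<ge> 0"
      using stable_symmetric_semi_gamma_positive[OF sym pos stable]
      by (rule semi_gamma_positive_poly_nonneg) simp
    moreover have "real (m n) * (\<mu> n + \<nu> n) \<le> 0"
      using mu_nu by (simp add: mult_nonneg_nonpos)
    \<comment> \<open>By the hypothesis on \<beta> the left side is at least
      \<open>- 2 * m n * \<mu> n\<close>, and \<mu> is nonpositive.\<close>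
    then have "2 * \<beta> n + real (m n) * \<nu> n - real (m n) * \<mu> n \<ge> 0"
      using beta[of n] mult_nonneg_nonneg[of "real (m n)" "\<nu> n"] nu_nonneg[of n]
        mult_nonneg_nonpos[of "real (m n)" "\<mu> n"] mu_nonpos[of n]
      by linarith
    \<comment> \<open>The cubic factor vanishes at 1, so the derivative drops out.\<close>
    moreover have "poly (T (Suc n)) 1
        = (2 * \<beta> n + real (m n) * \<nu> n - real (m n) * \<mu> n) * poly (T n) 1"
      unfolding rec by (simp add: algebra_simps)
    ultimately have "poly (T (Suc n)) 1 \<ge> 0" by simp
    with sym' stable' nz' show ?case
      using stable_symmetric_lead_coeff_pos by blast
  qed
  then show "hurwitz_stable (cpoly (T n)) \<and> semi_gamma_positive (T n)"
    using stable_symmetric_semi_gamma_positive by blast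
qed

end
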